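(* Let $F$ be a field with $\mathrm{char}(F)\ne2$. The atomic inflection polynomials $P_n$ of the hyperelliptic curve over $F$ defined by the affine equation $y^2=f(x)$ may be obtained by applying the recursive relation $$P_{n+1}=\frac1{n+1}\left((D^1P_n)\cdot f+\left(-n+\frac12\right)P_n\cdot(D^1f)\right)$$ for every $n\ge1$, subject to the seed datum $P_1=\frac12D^1f$.
   Context: $D^k$ denotes the $k$-th Hasse derivative with respect to $x$: on polynomials, $D^k(\sum a_ix^i)=\sum_{i\ge k}\binom ika_ix^{i-k}$, extended uniquely to $F[x,y,y^{-1}]/(y^2-f(x))$ as $F$-linear maps with $D^0=\mathrm{id}$ and $D^k(\phi\psi)=\sum_{i=0}^kD^i\phi\,D^{k-i}\psi$. Here $f\in F[x]$ has odd degree $2g+1$ and no repeated roots over $\overline F$. The $n$-th atomic inflection polynomial $P_n\in F[x]$ is defined by $D^ny=f^{-n}y\cdot P_n(x)$, $n\ge1$.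
   Formalization: Where char(F) divides n+1 the factor 1/(n+1) is undefined; the formula is stated for n+1 invertible in F, with denominator cleared for all n≥1, and via lifts of f to characteristic-0 domains containing 1/2, whose recursion values reduce to the P_n. *)

theory Defs
  imports
    "HOL-Computational_Algebra.Computational_Algebra"
    "HOL-Algebra.Algebraic_Closure_Type"
    "HOL-Algebra.QuotRing"
begin

definition hasse_poly :: "nat \<Rightarrow> 'a::comm_semiring_1 poly \<Rightarrow> 'a poly" where
  "hasse_poly k p =
     (\<Sum>i = k..Polynomial.degree p.
        Polynomial.monom (of_nat (i choose k) * Polynomial.coeff p i) (i - k))"

text \<open>
  The ring \<open>F[x, y, y\<^sup>-\<^sup>1]/(y\<^sup>2 - f(x))\<close> is taken as \<open>F[x][y][z]/(y z - 1, y\<^sup>2 - f(x))\<close>. In the type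
  \<^typ>\<open>'a poly poly poly\<close> the innermost variable is \<open>x\<close>, the middle one \<open>y\<close> and the outermost one
  \<open>z\<close>; elements of the quotient are cosets.
\<close>

definition x_poly :: "'a::field poly \<Rightarrow> 'a poly poly poly" where
  "x_poly p = [:[:p:]:]"

definition y_var :: "'a::field poly poly poly" where
  "y_var = [:[:0, 1:]:]"

definition z_var :: "'a::field poly poly poly" where
  "z_var = [:0, 1:]"

definition curve_ideal :: "'a::field poly \<Rightarrow> 'a poly poly poly set" where
  "curve_ideal f = genideal ring_of_type_algebra {y_var * z_var - 1, y_var ^ 2 - x_poly f}"

definition curve_ring :: "'a::field poly \<Rightarrow> 'a poly poly poly set ring" where
  "curve_ring f = FactRing ring_of_type_algebra (curve_ideal f)"

definition curve_class :: "'a::field poly \<Rightarrow> 'a poly poly poly \<Rightarrow> 'a poly poly poly set" where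
  "curve_class f r = a_r_coset ring_of_type_algebra (curve_ideal f) r"

text \<open>
  Extensionality (\<open>\<rightarrow>\<^sub>E\<close>) fixes the values outside the carrier, so that a system of
  maps with the stated properties is unique as an HOL function.
\<close>

definition is_hasse_extension ::
  "'a::field poly \<Rightarrow> (nat \<Rightarrow> 'a poly poly poly set \<Rightarrow> 'a poly poly poly set) \<Rightarrow> bool" where
  "is_hasse_extension f D \<longleftrightarrow>
     (let A = curve_ring f in
       (\<forall>k. D k \<in> carrier A \<rightarrow>\<^sub>E carrier A) \<and>
       (\<forall>k p. D k (curve_class f (x_poly p)) = curve_class f (x_poly (hasse_poly k p))) \<and>
       (\<forall>k. \<forall>\<phi>\<in>carrier A. \<forall>\<psi>\<in>carrier A. D k (\<phi> \<oplus>\<^bsub>A\<^esub> \<psi>) = D k \<phi> \<oplus>\<^bsub>A\<^esub> D k \<psi>) \<and>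
       (\<forall>k c. \<forall>\<phi>\<in>carrier A.
          D k (curve_class f (x_poly [:c:]) \<otimes>\<^bsub>A\<^esub> \<phi>) = curve_class f (x_poly [:c:]) \<otimes>\<^bsub>A\<^esub> D k \<phi>) \<and>
       (\<forall>\<phi>\<in>carrier A. D 0 \<phi> = \<phi>) \<and>
       (\<forall>k. \<forall>\<phi>\<in>carrier A. \<forall>\<psi>\<in>carrier A.
          D k (\<phi> \<otimes>\<^bsub>A\<^esub> \<psi>) = (\<Oplus>\<^bsub>A\<^esub>i\<in>{0..k}. D i \<phi> \<otimes>\<^bsub>A\<^esub> D (k - i) \<psi>)))"

definition hasse_curve ::
  "'a::field poly \<Rightarrow> nat \<Rightarrow> 'a poly poly poly set \<Rightarrow> 'a poly poly poly set" where
  "hasse_curve f = (THE D. is_hasse_extension f D)"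

definition atomic_inflection :: "'a::field poly \<Rightarrow> nat \<Rightarrow> 'a poly" where
  "atomic_inflection f n =
     (THE P. hasse_curve f n (curve_class f y_var) =
        ((inv\<^bsub>curve_ring f\<^esub> (curve_class f (x_poly f))) [^]\<^bsub>curve_ring f\<^esub> n)
          \<otimes>\<^bsub>curve_ring f\<^esub> curve_class f y_var \<otimes>\<^bsub>curve_ring f\<^esub> curve_class f (x_poly P))"

text \<open>
  The recursion with denominators cleared, over a ring in which \<open>h\<close> is a half. The value
  \<open>Q 0\<close> is unconstrained. If no \<open>n + 1\<close> is a zero divisor, the recursion determines
  all \<open>Q n\<close> with \<open>n \<ge> 1\<close>. Over a field of characteristic \<open>p > 0\<close> the factor \<open>1/(n + 1)\<close> does
  not exist when \<open>p\<close> divides \<open>n + 1\<close>; there the recursion is run on a lift of \<open>f\<close> to a domain of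
  characteristic \<open>0\<close> containing \<open>1/2\<close>, and the result is reduced.
\<close>

definition inflection_recursion ::
  "'r::comm_ring_1 \<Rightarrow> 'r poly \<Rightarrow> (nat \<Rightarrow> 'r poly) \<Rightarrow> bool" where
  "inflection_recursion h f Q \<longleftrightarrow>
     Q 1 = smult h (hasse_poly 1 f) \<and>
     (\<forall>n\<ge>1. smult (of_nat (n + 1)) (Q (n + 1)) =
        hasse_poly 1 (Q n) * f + smult (- of_nat n + h) (Q n) * hasse_poly 1 f)"

end

theory Submission
  imports Defs
begin

text \<open>
  The Hasse derivatives are the coefficients of the substitution \<open>x \<mapsto> x + t\<close>. Put \<open>t = f s\<close>: then
  \<open>G = f(x + f s) / f(x)\<close> is a power series in \<open>s\<close> over \<open>F[x]\<close> with constant term \<open>1\<close>, so it has a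
  square root \<open>S\<close>, and \<open>y\<close> must go to \<open>y S(t / f)\<close>. Hence \<open>P\<^sub>n\<close> is the coefficient of \<open>s\<^sup>n\<close>
  in \<open>S\<close>. From \<open>\<partial>\<^sub>x D\<^sup>k = (k + 1) D\<^sup>k\<^sup>+\<^sup>1\<close> one gets
  \<open>(1 + f' s) \<partial>\<^sub>s G = f \<partial>\<^sub>x G + f' G\<close>, and \<open>G = S\<^sup>2\<close> turns this into
  \<open>(1 + f' s) \<partial>\<^sub>s S = f \<partial>\<^sub>x S + f' S / 2\<close>, which is the recursion. The coefficients of \<open>S\<close> are
  given by formulas over \<open>\<int>[1/2]\<close>, so they are compatible with ring homomorphisms.
\<close>

section \<open>Hasse derivatives and the recursion\<close>

lemma coeff_hasse_poly:
  "Polynomial.coeff (hasse_poly k p) j = of_nat ((k + j) choose k) * Polynomial.coeff p (k + j)"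
proof -
  have "Polynomial.coeff (hasse_poly k p) j
      = (\<Sum>i = k..Polynomial.degree p. if i = k + j then of_nat (i choose k) * Polynomial.coeff p i else 0)"
    unfolding hasse_poly_def Polynomial.coeff_sum by (rule sum.cong) auto
  also have "\<dots> = of_nat ((k + j) choose k) * Polynomial.coeff p (k + j)"
    by (auto simp: sum.delta coeff_eq_0)
  finally show ?thesis .
qed

lemma hasse_poly_0 [simp]: "hasse_poly 0 p = p"
  by (rule poly_eqI) (simp add: coeff_hasse_poly)

lemma hasse_poly_zero [simp]: "hasse_poly k 0 = 0"
  by (rule poly_eqI) (simp add: coeff_hasse_poly)

lemma hasse_poly_add: "hasse_poly k (p + q) = hasse_poly k p + hasse_poly k q"
  by (rule poly_eqI) (simp add: coeff_hasse_poly distrib_left)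

lemma hasse_poly_smult: "hasse_poly k (smult c p) = smult c (hasse_poly k p)"
  by (rule poly_eqI) (simp add: coeff_hasse_poly mult.left_commute)

text \<open>Compare coefficients of \<open>t^(k+1)\<close> in \<open>a + (x + t) p(x + t)\<close>.
  On coefficients in \<open>x\<close> it is Pascal's rule.\<close>

lemma hasse_poly_Suc_pCons:
  "hasse_poly (Suc k) (pCons a p) = hasse_poly k p + pCons 0 (hasse_poly (Suc k) p)"
proof (rule poly_eqI)
  fix n
  show "Polynomial.coeff (hasse_poly (Suc k) (pCons a p)) n =
      Polynomial.coeff (hasse_poly k p + pCons 0 (hasse_poly (Suc k) p)) n"
    by (cases n) (simp_all add: coeff_hasse_poly coeff_pCons algebra_simps split: nat.split)
qed

lemma hasse_poly_1: "hasse_poly (Suc 0) p = pderiv (p :: 'a::idom poly)"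
  by (rule poly_eqI) (simp add: coeff_hasse_poly coeff_pderiv)

text \<open>The absorption identity for binomial coefficients. It links consecutive Hasse
  derivatives without dividing by \<open>k + 1\<close>.\<close>

lemma pderiv_hasse_poly:
  "pderiv (hasse_poly k p) = of_nat (Suc k) * hasse_poly (Suc k) (p :: 'a::idom poly)"
proof (rule poly_eqI)
  fix n
  have "Suc n * (k + Suc n choose k) = Suc k * (Suc k + n choose Suc k)"
    using binomial_absorb_comp[of "Suc (k + n)" k] Suc_times_binomial[of k "k + n"]
    by (simp del: binomial_Suc_Suc mult_Suc)
  then have "(of_nat (Suc n) * of_nat (k + Suc n choose k) :: 'a)
      = of_nat (Suc k) * of_nat (Suc k + n choose Suc k)"
    by (metis of_nat_mult)
  then show "Polynomial.coeff (pderiv (hasse_poly k p)) n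
      = Polynomial.coeff (of_nat (Suc k) * hasse_poly (Suc k) p) n"
    by (simp add: coeff_hasse_poly coeff_pderiv of_nat_poly mult.assoc[symmetric] del: of_nat_Suc binomial_Suc_Suc)
qed

section \<open>The Taylor expansion \<open>p(x + t)\<close> as a power series in
  \<open>t\<close>\<close>

definition hasse_series :: "'a::comm_semiring_1 poly \<Rightarrow> 'a poly fps" where
  "hasse_series p = Abs_fps (\<lambda>k. hasse_poly k p)"

lemma hasse_series_nth [simp]: "hasse_series p $ k = hasse_poly k p"
  by (simp add: hasse_series_def)

lemma hasse_series_add: "hasse_series (p + q) = hasse_series p + hasse_series q"
  by (rule fps_ext) (simp add: hasse_poly_add)

lemma hasse_series_smult: "hasse_series (smult c p) = fps_const [:c:] * hasse_series p"
  by (rule fps_ext) (simp add: hasse_poly_smult)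

lemma hasse_series_pCons:
  "hasse_series (pCons a p) = fps_const [:a:] + (fps_const [:0, 1:] + fps_X) * hasse_series p"
proof (rule fps_ext)
  fix n
  show "hasse_series (pCons a p) $ n =
      (fps_const [:a:] + (fps_const [:0, 1:] + fps_X) * hasse_series p) $ n"
    by (cases n) (simp_all add: hasse_poly_Suc_pCons distrib_right add.commute)
qed

lemma hasse_series_0: "hasse_series 0 = 0"
  by (rule fps_ext) simp

text \<open>Induction on \<open>p\<close>, where each step multiplies by the image
  \<open>x + t\<close> of \<open>x\<close>, takes the place of a Vandermonde convolution. Comparing
  coefficients gives the Leibniz rule.\<close>

lemma hasse_series_mult:
  "hasse_series (p * q) = hasse_series p * hasse_series (q :: 'a::comm_ring_1 poly)"
proof (induction p)
  case 0
  show ?case by (simp add: hasse_series_0)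
next
  case (pCons a p)
  have "hasse_series (pCons a p * q) = hasse_series (smult a q) + hasse_series (pCons 0 (p * q))"
    by (simp add: hasse_series_add)
  then show ?case
    by (simp add: hasse_series_smult hasse_series_pCons pCons.IH algebra_simps)
qed

lemma hasse_series_1: "hasse_series 1 = 1"
  using hasse_series_pCons[of 1 0] by (simp add: hasse_series_0 flip: one_pCons)

section \<open>Square roots of power series with constant term 1\<close>

fun sqrt_coeff :: "'r::comm_ring_1 \<Rightarrow> (nat \<Rightarrow> 'r) \<Rightarrow> nat \<Rightarrow> 'r" where
  "sqrt_coeff h G n =
     (if n = 0 then 1
      else h * (G n - (\<Sum>i\<in>{0<..<n}. sqrt_coeff h G i * sqrt_coeff h G (n - i))))"

declare sqrt_coeff.simps [simp del]

lemma sqrt_coeff_0 [simp]: "sqrt_coeff h G 0 = 1"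
  by (simp add: sqrt_coeff.simps)

text \<open>The two end terms of the \<open>n\<close>-th convolution contribute
  \<open>2 * S n\<close>; \<open>sqrt_coeff\<close> solves for \<open>S n\<close>, with
  \<open>h\<close> in place of a division by 2.\<close>

lemma sqrt_coeff_square:
  assumes h: "2 * h = 1" and G: "G 0 = 1"
  shows "Abs_fps (sqrt_coeff h G) * Abs_fps (sqrt_coeff h G) = Abs_fps G"
proof (rule fps_ext)
  fix n
  define S where "S = sqrt_coeff h G"
  show "(Abs_fps (sqrt_coeff h G) * Abs_fps (sqrt_coeff h G)) $ n = Abs_fps G $ n"
  proof (cases "n = 0")
    case True
    then show ?thesis using G by simp
  next
    case False
    then have set: "{0..n} = insert 0 (insert n {0<..<n})" by auto
    have "(\<Sum>i=0..n. S i * S (n - i)) = S 0 * S n + (S n * S 0 + (\<Sum>i\<in>{0<..<n}. S i * S (n - i)))"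
      unfolding set using False by (subst sum.insert; simp)
    then have "(\<Sum>i=0..n. S i * S (n - i)) = 2 * S n + (\<Sum>i\<in>{0<..<n}. S i * S (n - i))"
      by (simp add: S_def)
    moreover have "2 * S n = (2 * h) * (G n - (\<Sum>i\<in>{0<..<n}. S i * S (n - i)))"
      using False unfolding S_def by (subst sqrt_coeff.simps) (simp add: mult.assoc)
    ultimately show ?thesis by (simp add: fps_mult_nth S_def h)
  qed
qed

section \<open>The differential equation and the recursion\<close>

text \<open>
  The generating series of \<open>taylor_quotient f\<close> is \<open>f(x + f s) / f(x)\<close>.
\<close>

definition taylor_quotient :: "'r::comm_ring_1 poly \<Rightarrow> nat \<Rightarrow> 'r poly" where
  "taylor_quotient f k = (if k = 0 then 1 else f ^ (k - 1) * hasse_poly k f)"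

text \<open>The half is a parameter, so that one formula serves the field and its lifts to
  characteristic 0.\<close>

definition inflection_poly :: "'r::comm_ring_1 \<Rightarrow> 'r poly \<Rightarrow> nat \<Rightarrow> 'r poly" where
  "inflection_poly h f = sqrt_coeff [:h:] (taylor_quotient f)"

lemma inflection_poly_square:
  assumes "2 * h = 1"
  shows "Abs_fps (inflection_poly h f) * Abs_fps (inflection_poly h f) = Abs_fps (taylor_quotient f)"
  unfolding inflection_poly_def
  by (rule sqrt_coeff_square)
    (use assms in \<open>simp_all add: taylor_quotient_def numeral_poly one_pCons mult.commute[of h]\<close>)

text \<open>The coefficient of \<open>s^k\<close> in
  \<open>(1 + f' s) \<partial>_s G = f \<partial>_x G + f' G\<close>, obtained from the product rule
  and \<open>pderiv_hasse_poly\<close>. The cases \<open>k = 0\<close> and \<open>k = 1\<close>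
  stand apart because the derivative of \<open>f^(k-1)\<close> involves the exponent
  \<open>k - 2\<close>.\<close>

lemma taylor_quotient_deriv:
  fixes f :: "'r::idom poly"
  shows "of_nat (Suc k) * taylor_quotient f (Suc k) + of_nat k * pderiv f * taylor_quotient f k
    = f * pderiv (taylor_quotient f k) + pderiv f * taylor_quotient f k"
proof (cases k)
  case 0
  then show ?thesis by (simp add: taylor_quotient_def hasse_poly_1)
next
  case (Suc m)
  show ?thesis
  proof (cases m)
    case 0
    then show ?thesis using Suc pderiv_hasse_poly[of 1 f]
      by (simp add: taylor_quotient_def algebra_simps)
  next
    case (Suc l)
    then have k: "k = Suc (Suc l)" using \<open>k = Suc m\<close> by simp
    have "pderiv (f ^ Suc l) = of_nat (Suc l) * f ^ l * pderiv f"
      by (simp add: pderiv_power_Suc of_nat_poly del: of_nat_Suc power_Suc)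
    then show ?thesis using pderiv_hasse_poly[of k f]
      by (simp add: k taylor_quotient_def pderiv_mult del: power_Suc)
        (simp add: algebra_simps)
  qed
qed

text \<open>The equation for \<open>G\<close> is \<open>2 S\<close> times the one for
  \<open>S\<close>, and \<open>2 S\<close> cancels in a domain. Nothing is divided by
  \<open>n + 1\<close>, so positive characteristic is covered.\<close>

lemma inflection_poly_recursion:
  fixes f :: "'r::idom poly"
  assumes h: "2 * h = 1"
  shows "inflection_recursion h f (inflection_poly h f)"
proof -
  define P where "P = inflection_poly h f"
  define S where "S = Abs_fps P"
  \<comment> \<open>\<open>d\<close> differentiates in \<open>x\<close>, \<open>fps_deriv\<close> in
    \<open>s\<close>. \<open>E c A\<close> is the defect of \<open>A\<close> in the differential
    equation, with \<open>c = 1\<close> meant for \<open>G\<close> and \<open>c = h\<close> for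
    \<open>S\<close>.\<close>
  define d :: "'r poly fps \<Rightarrow> 'r poly fps" where "d = (\<lambda>A. Abs_fps (\<lambda>n. pderiv (A $ n)))"
  define E where "E = (\<lambda>c A. (1 + fps_const (pderiv f) * fps_X) * fps_deriv A
    - fps_const f * d A - fps_const (smult c (pderiv f)) * A)"
  have E_nth: "E c A $ n = of_nat (Suc n) * A $ Suc n + of_nat n * pderiv f * A $ n
      - f * pderiv (A $ n) - smult c (pderiv f) * A $ n" for c A n
    by (cases n) (simp_all add: E_def d_def distrib_right mult.assoc, simp_all add: algebra_simps)
  have d_sq: "d (A * A) = 2 * A * d A" for A
  proof -
    have "d (A * A) $ n = (A * d A) $ n + (d A * A) $ n" for n
      unfolding fps_mult_nth d_def
      by (simp add: higher_pderiv_sum[of 1, simplified] pderiv_mult sum.distrib)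
        (simp add: mult.commute)
    then have "d (A * A) = A * d A + d A * A"
      by (intro fps_ext) (simp only: fps_add_nth)
    then show ?thesis by (simp add: mult.commute[of "d A"])
  qed
  \<comment> \<open>Apart from its last term \<open>E\<close> acts as a derivation, and
    \<open>2 * h = 1\<close> makes the last term fit.\<close>
  have "2 * fps_const (smult h (pderiv f)) = fps_const (smult 1 (pderiv f))"
    by (simp add: h numeral_fps_const numeral_poly mult.commute[of h])
  then have "2 * S * E h S = E 1 (S * S)"
    unfolding E_def d_sq fps_deriv_mult by (simp add: algebra_simps) 
  also have "S * S = Abs_fps (taylor_quotient f)"
    unfolding S_def P_def by (rule inflection_poly_square[OF h])
  also have "E 1 \<dots> = 0"
    by (rule fps_ext) (simp add: E_nth taylor_quotient_deriv del: of_nat_Suc)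
  finally have "2 * S * E h S = 0" .
  moreover have "S \<noteq> 0"
    by (auto simp: S_def P_def inflection_poly_def fps_eq_iff intro: exI[of _ 0])
  moreover have "(2 :: 'r poly fps) \<noteq> 0"
  proof
    assume "(2 :: 'r poly fps) = 0"
    then have "[:2 :: 'r:] = 0" by (metis fps_numeral_nth_0 fps_zero_nth numeral_poly)
    with h show False by simp
  qed
  ultimately have "E h S = 0" by simp
  then have "E h S $ n = 0" for n by simp
  then have rec: "of_nat (Suc n) * P (Suc n) = f * pderiv (P n) + smult h (pderiv f) * P n
      - of_nat n * pderiv f * P n" for n
    unfolding E_nth by (simp add: S_def algebra_simps eq_diff_eq)
  \<comment> \<open>\<open>P 0\<close> is 1, so the equation at index 0 is the seed.\<close>
  have "P 1 = smult h (hasse_poly 1 f)"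
    using rec[of 0] by (simp add: hasse_poly_1 P_def inflection_poly_def)
  moreover have "smult (of_nat (n + 1)) (P (n + 1)) =
        hasse_poly 1 (P n) * f + smult (- of_nat n + h) (P n) * hasse_poly 1 f" for n
    using rec[of n] by (simp add: hasse_poly_1 of_nat_poly smult_add_left smult_diff_left algebra_simps)
  ultimately show ?thesis
    by (simp add: inflection_recursion_def P_def)
qed

text \<open>In characteristic 0 the factor \<open>n + 1\<close> cancels, so the seed propagates to
  all later indices.\<close>

lemma inflection_recursion_unique:
  fixes f :: "'r::{idom,ring_char_0} poly"
  assumes "inflection_recursion h f P" "inflection_recursion h f Q" "n \<ge> 1"
  shows "P n = Q n"
  using \<open>n \<ge> 1\<close>
proof (induction n rule: dec_induct)
  case base
  then show ?case using assms by (simp add: inflection_recursion_def)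
next
  case (step n)
  then have "smult (of_nat (n + 1)) (P (n + 1)) = smult (of_nat (n + 1)) (Q (n + 1))"
    using assms unfolding inflection_recursion_def by metis
  then have "smult (of_nat (n + 1)) (P (n + 1) - Q (n + 1)) = 0"
    by (simp add: smult_diff_right)
  then show ?case
    by (simp del: of_nat_add of_nat_Suc)
qed

section \<open>Ring homomorphisms and ideals\<close>

text \<open>Rings are types here rather than carriers, since the targets in use (polynomials, power
  series, an algebraic closure) are types.\<close>

locale type_ring_hom =
  fixes \<phi> :: "'a::comm_ring_1 \<Rightarrow> 'b::comm_ring_1"
  assumes hom_add: "\<phi> (x + y) = \<phi> x + \<phi> y"
    and hom_mult: "\<phi> (x * y) = \<phi> x * \<phi> y"
    and hom_one: "\<phi> 1 = 1"
begin

lemma hom_zero: "\<phi> 0 = 0"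
  using hom_add[of 0 0] by simp

lemma hom_minus: "\<phi> (- x) = - \<phi> x"
  using hom_add[of x "- x"] by (simp add: hom_zero add_eq_0_iff)

lemma hom_diff: "\<phi> (x - y) = \<phi> x - \<phi> y"
  using hom_add[of x "- y"] by (simp add: hom_minus)

lemma hom_sum: "\<phi> (\<Sum>i\<in>A. g i) = (\<Sum>i\<in>A. \<phi> (g i))"
  by (induction A rule: infinite_finite_induct) (simp_all add: hom_zero hom_add)

lemma hom_power: "\<phi> (x ^ n) = \<phi> x ^ n"
  by (induction n) (simp_all add: hom_one hom_mult)

lemma hom_of_nat: "\<phi> (of_nat n) = of_nat n"
  by (induction n) (simp_all add: hom_zero hom_one hom_add)

lemma map_poly_hom: "type_ring_hom (map_poly \<phi>)"
proof
  fix p q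
  show "map_poly \<phi> (p + q) = map_poly \<phi> p + map_poly \<phi> q"
    by (rule poly_eqI) (simp add: coeff_map_poly hom_zero hom_add)
  show "map_poly \<phi> (p * q) = map_poly \<phi> p * map_poly \<phi> q"
    by (rule poly_eqI) (simp add: coeff_map_poly coeff_mult hom_zero hom_mult hom_sum)
qed (simp add: hom_one)

lemma map_poly_const: "map_poly \<phi> [:c:] = [:\<phi> c:]"
  by (simp add: map_poly_pCons hom_zero)

lemma map_poly_hasse_poly: "map_poly \<phi> (hasse_poly k p) = hasse_poly k (map_poly \<phi> p)"
  by (rule poly_eqI) (simp add: coeff_map_poly coeff_hasse_poly hom_zero hom_mult hom_of_nat)

text \<open>The coefficients arise from \<open>h\<close> and the \<open>G k\<close> by ring
  operations alone.\<close>

lemma hom_sqrt_coeff: "\<phi> (sqrt_coeff h G n) = sqrt_coeff (\<phi> h) (\<lambda>k. \<phi> (G k)) n"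
proof (induction n rule: less_induct)
  case (less n)
  show ?case
  proof (cases "n = 0")
    case False
    then show ?thesis using less
      by (subst (1 2) sqrt_coeff.simps) (simp add: hom_mult hom_diff hom_sum)
  qed (simp add: hom_one)
qed

lemma map_poly_taylor_quotient:
  "map_poly \<phi> (taylor_quotient f k) = taylor_quotient (map_poly \<phi> f) k"
proof -
  interpret M: type_ring_hom "map_poly \<phi>" by (rule map_poly_hom)
  show ?thesis
    by (simp add: taylor_quotient_def M.hom_one M.hom_mult M.hom_power map_poly_hasse_poly hom_one)
qed

text \<open>This justifies reducing a lift: it holds no matter which integers vanish in the
  target.\<close>

lemma map_poly_inflection_poly:
  "map_poly \<phi> (inflection_poly h f n) = inflection_poly (\<phi> h) (map_poly \<phi> f) n"
proof -
  interpret M: type_ring_hom "map_poly \<phi>" by (rule map_poly_hom)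
  show ?thesis
    by (simp add: inflection_poly_def M.hom_sqrt_coeff map_poly_taylor_quotient map_poly_const)
qed

end

section \<open>Evaluation homomorphisms\<close>

definition eval_hom :: "('a::comm_ring_1 \<Rightarrow> 'b::comm_ring_1) \<Rightarrow> 'b \<Rightarrow> 'a poly \<Rightarrow> 'b" where
  "eval_hom \<phi> s p = poly (map_poly \<phi> p) s"

lemma eval_hom_hom:
  assumes "type_ring_hom \<phi>"
  shows "type_ring_hom (eval_hom \<phi> s)"
proof -
  interpret M: type_ring_hom "map_poly \<phi>" by (rule type_ring_hom.map_poly_hom[OF assms])
  show ?thesis
    by unfold_locales (simp_all add: eval_hom_def M.hom_add M.hom_mult M.hom_one)
qed

lemma eval_hom_const: "type_ring_hom \<phi> \<Longrightarrow> eval_hom \<phi> s [:c:] = \<phi> c"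
  by (simp add: eval_hom_def type_ring_hom.map_poly_const)

lemma eval_hom_var: "type_ring_hom \<phi> \<Longrightarrow> eval_hom \<phi> s [:0, 1:] = s"
  by (simp add: eval_hom_def map_poly_pCons type_ring_hom.hom_zero type_ring_hom.hom_one)

section \<open>Ideals of type-class rings and of their power series\<close>

lemma ideal_type_algebra_iff:
  fixes I :: "'r::comm_ring_1 set"
  shows "ideal I ring_of_type_algebra \<longleftrightarrow>
    0 \<in> I \<and> (\<forall>a\<in>I. \<forall>b\<in>I. a + b \<in> I) \<and> (\<forall>r. \<forall>a\<in>I. r * a \<in> I)"
    (is "?L \<longleftrightarrow> ?R")
proof
  assume ?L
  then interpret ideal I "ring_of_type_algebra :: 'r ring" .
  show ?R
    using additive_subgroup.zero_closed[OF is_additive_subgroup]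
      additive_subgroup.a_closed[OF is_additive_subgroup] I_l_closed
    by (simp add: ring_of_type_algebra_def)
next
  assume R: ?R
  interpret R: ring "ring_of_type_algebra :: 'r ring" by (rule ring_from_type_algebra)
  have "subgroup I (add_monoid (ring_of_type_algebra :: 'r ring))"
  proof
    fix x assume "x \<in> I"
    have "a_inv (ring_of_type_algebra :: 'r ring) x = - x"
      by (rule R.minus_equality) (simp_all add: ring_of_type_algebra_def)
    \<comment> \<open>Closure under negation comes from multiplication by \<open>-1\<close>.\<close>
    moreover have "- 1 * x \<in> I" using R \<open>x \<in> I\<close> by blast
    ultimately show "inv\<^bsub>add_monoid (ring_of_type_algebra :: 'r ring)\<^esub> x \<in> I"
      by (simp add: a_inv_def)
  qed (use R in \<open>simp_all add: ring_of_type_algebra_def\<close>)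
  then show ?L
    using R by (intro idealI R.ring_axioms) (simp_all add: ring_of_type_algebra_def, metis mult.commute)
qed

lemma ideal_type_algebra_minus:
  fixes I :: "'r::comm_ring_1 set"
  assumes "ideal I ring_of_type_algebra" "a \<in> I"
  shows "- a \<in> I"
proof -
  have "- 1 * a \<in> I" using assms unfolding ideal_type_algebra_iff by blast
  then show ?thesis by simp
qed

lemma ideal_type_algebra_diff:
  fixes I :: "'r::comm_ring_1 set"
  assumes "ideal I ring_of_type_algebra" "a \<in> I" "b \<in> I"
  shows "a - b \<in> I"
  using ideal_type_algebra_minus[OF assms(1,3)] assms
  unfolding ideal_type_algebra_iff by (metis add_uminus_conv_diff)

lemma ideal_type_algebra_sum:
  fixes I :: "'r::comm_ring_1 set"
  assumes "ideal I ring_of_type_algebra" "\<And>i. i \<in> A \<Longrightarrow> g i \<in> I"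
  shows "sum g A \<in> I"
  using assms(2)
  by (induction A rule: infinite_finite_induct) (use assms(1) in \<open>auto simp: ideal_type_algebra_iff\<close>)

text \<open>Used to show that \<open>curve_ideal f\<close> lies in a preimage by checking its two
  generators.\<close>

lemma ideal_vimage_type_algebra:
  assumes "type_ring_hom \<phi>" "ideal J ring_of_type_algebra"
  shows "ideal (\<phi> -` J) ring_of_type_algebra"
  using assms(2)
  by (simp add: ideal_type_algebra_iff type_ring_hom.hom_zero[OF assms(1)]
      type_ring_hom.hom_add[OF assms(1)] type_ring_hom.hom_mult[OF assms(1)])

text \<open>The kernel of reducing coefficients modulo an ideal \<open>I\<close>. The quotient ring
  is not a type, so power series over it are replaced by power series over the full ring modulo this
  ideal.\<close>

definition fps_ideal :: "'r::comm_ring_1 set \<Rightarrow> 'r fps set" where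
  "fps_ideal I = {A. \<forall>k. A $ k \<in> I}"

lemma fps_ideal_ideal:
  fixes I :: "'r::comm_ring_1 set"
  assumes I: "ideal I ring_of_type_algebra"
  shows "ideal (fps_ideal I) ring_of_type_algebra"
proof -
  have "(r * a) $ k \<in> I" if "a \<in> fps_ideal I" for r a k
    unfolding fps_mult_nth
    by (rule ideal_type_algebra_sum[OF I])
      (use that I in \<open>auto simp: fps_ideal_def ideal_type_algebra_iff\<close>)
  then show ?thesis
    using I by (simp add: ideal_type_algebra_iff fps_ideal_def)
qed

text \<open>Modulo \<open>I\<close>, \<open>u\<close> inverts the constant term of \<open>B\<close>,
  so \<open>B\<close> is a unit. The coefficients of \<open>A\<close> are treated in increasing
  order, each isolated in the convolution by the earlier ones.\<close>

lemma fps_ideal_cancel: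
  fixes I :: "'r::comm_ring_1 set"
  assumes I: "ideal I ring_of_type_algebra"
    and AB: "A * B \<in> fps_ideal I" and u: "u * B $ 0 - 1 \<in> I"
  shows "A \<in> fps_ideal I"
proof -
  have "A $ n \<in> I" for n
  proof (induction n rule: less_induct)
    case (less n)
    have "(A * B) $ n = A $ n * B $ 0 + (\<Sum>i<n. A $ i * B $ (n - i))"
      by (simp add: fps_mult_nth atLeast0AtMost lessThan_Suc_atMost[symmetric] add.commute)
    moreover have "(\<Sum>i<n. A $ i * B $ (n - i)) \<in> I"
      by (rule ideal_type_algebra_sum[OF I])
        (use less I in \<open>simp add: ideal_type_algebra_iff mult.commute[of "A $ _"]\<close>)
    moreover have "(A * B) $ n \<in> I" using AB by (simp add: fps_ideal_def)
    ultimately have "A $ n * B $ 0 \<in> I"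
      using ideal_type_algebra_diff[OF I] by (metis add_diff_cancel_right')
    \<comment> \<open>The difference of these two elements is \<open>A $ n\<close>.\<close>
    then have "u * (A $ n * B $ 0) \<in> I" "A $ n * (u * B $ 0 - 1) \<in> I"
      using I u by (auto simp: ideal_type_algebra_iff)
    then have "u * (A $ n * B $ 0) - A $ n * (u * B $ 0 - 1) \<in> I"
      by (rule ideal_type_algebra_diff[OF I])
    then show ?case by (simp add: algebra_simps)
  qed
  then show ?thesis by (simp add: fps_ideal_def)
qed

section \<open>The coordinate ring\<close>

lemma x_poly_hom: "type_ring_hom (x_poly :: 'a::field poly \<Rightarrow> _)"
  by unfold_locales (simp_all add: x_poly_def one_pCons)

interpretation x_poly: type_ring_hom "x_poly :: 'a::field poly \<Rightarrow> _"
  by (rule x_poly_hom)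

text \<open>\<open>F[x]\<close>, \<open>y\<close> and \<open>z\<close> generate the ring: Horner's
  scheme in \<open>z\<close>, then in \<open>y\<close>. Claims about homomorphisms thus reduce to
  generators.\<close>

lemma poly3_induct [case_names x_poly y z add mult]:
  assumes "\<And>p. P (x_poly p)" "P y_var" "P z_var"
    and add: "\<And>r s. P r \<Longrightarrow> P s \<Longrightarrow> P (r + s)"
    and mult: "\<And>r s. P r \<Longrightarrow> P s \<Longrightarrow> P (r * s)"
  shows "P (r :: 'a::field poly poly poly)"
proof (induction r)
  case 0
  show ?case using assms(1)[of 0] by (simp add: x_poly_def)
next
  case (pCons a r)
  have "P [:a:]"
  proof (induction a)
    case 0
    show ?case using assms(1)[of 0] by (simp add: x_poly_def)
  next
    case (pCons p a)
    have "[:pCons p a:] = x_poly p + y_var * [:a:]"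
      by (simp add: x_poly_def y_var_def)
    then show ?case using add[OF assms(1) mult[OF assms(2) pCons.IH]] by metis
  qed
  moreover have "pCons a r = [:a:] + z_var * r" by (simp add: z_var_def)
  ultimately show ?case using add[OF _ mult[OF assms(3) pCons.IH]] by metis
qed

definition curve_eval ::
  "('a::field poly \<Rightarrow> 'b::comm_ring_1) \<Rightarrow> 'b \<Rightarrow> 'b \<Rightarrow> 'a poly poly poly \<Rightarrow> 'b" where
  "curve_eval \<phi> Y Z = eval_hom (eval_hom \<phi> Y) Z"

lemma curve_eval_hom: "type_ring_hom \<phi> \<Longrightarrow> type_ring_hom (curve_eval \<phi> Y Z)"
  by (simp add: curve_eval_def eval_hom_hom)

lemma curve_eval_simps:
  assumes "type_ring_hom \<phi>"
  shows "curve_eval \<phi> Y Z (x_poly p) = \<phi> p"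
    and "curve_eval \<phi> Y Z y_var = Y"
    and "curve_eval \<phi> Y Z z_var = Z"
  using assms
  by (simp_all add: curve_eval_def x_poly_def y_var_def z_var_def eval_hom_const eval_hom_var eval_hom_hom)

section \<open>The ideal of the curve and its cosets\<close>

lemma curve_ideal_ideal: "ideal (curve_ideal f) ring_of_type_algebra"
  unfolding curve_ideal_def
  by (rule ring.genideal_ideal[OF ring_from_type_algebra]) (simp add: ring_of_type_algebra_def)

lemma curve_ideal_gens: "y_var * z_var - 1 \<in> curve_ideal f" "y_var ^ 2 - x_poly f \<in> curve_ideal f"
  using ring.genideal_self[OF ring_from_type_algebra, of "{y_var * z_var - 1, y_var ^ 2 - x_poly f}"]
  by (auto simp: curve_ideal_def ring_of_type_algebra_def)

lemma curve_ideal_minimal: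
  assumes "ideal J ring_of_type_algebra" "y_var * z_var - 1 \<in> J" "y_var ^ 2 - x_poly f \<in> J"
  shows "curve_ideal f \<subseteq> J"
  unfolding curve_ideal_def
  by (rule ring.genideal_minimal[OF ring_from_type_algebra assms(1)]) (use assms in simp)

lemma mem_curve_class_iff: "s \<in> curve_class f r \<longleftrightarrow> s - r \<in> curve_ideal f"
proof -
  have "s \<in> curve_class f r \<longleftrightarrow> (\<exists>i\<in>curve_ideal f. s = i + r)"
    by (auto simp: curve_class_def a_r_coset_def' ring_of_type_algebra_def)
  also have "\<dots> \<longleftrightarrow> s - r \<in> curve_ideal f" by (metis add_diff_cancel_right' diff_add_cancel)
  finally show ?thesis .
qed

lemma curve_class_eq_iff: "curve_class f r = curve_class f s \<longleftrightarrow> r - s \<in> curve_ideal f"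
proof
  assume "curve_class f r = curve_class f s"
  moreover have "r \<in> curve_class f r"
    using curve_ideal_ideal[of f] by (simp add: mem_curve_class_iff ideal_type_algebra_iff)
  ultimately show "r - s \<in> curve_ideal f" by (simp flip: mem_curve_class_iff)
next
  assume rs: "r - s \<in> curve_ideal f"
  have "t - r \<in> curve_ideal f \<longleftrightarrow> t - s \<in> curve_ideal f" for t
  proof
    assume "t - r \<in> curve_ideal f"
    with rs have "(t - r) + (r - s) \<in> curve_ideal f"
      using curve_ideal_ideal[of f] unfolding ideal_type_algebra_iff by blast
    then show "t - s \<in> curve_ideal f" by simp
  next
    assume "t - s \<in> curve_ideal f"
    then have "(t - s) - (r - s) \<in> curve_ideal f"
      using ideal_type_algebra_diff[OF curve_ideal_ideal] rs by blast
    then show "t - r \<in> curve_ideal f" by simp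
  qed
  then show "curve_class f r = curve_class f s" by (auto simp: mem_curve_class_iff)
qed

lemma curve_class_ring_hom: "curve_class f \<in> ring_hom ring_of_type_algebra (curve_ring f)"
  using ideal.rcos_ring_hom[OF curve_ideal_ideal[of f]]
  by (simp add: curve_ring_def curve_class_def[abs_def])

lemma curve_class_add: "curve_class f (r + s) = curve_class f r \<oplus>\<^bsub>curve_ring f\<^esub> curve_class f s"
  using ring_hom_add[OF curve_class_ring_hom, of r s f] by (simp add: ring_of_type_algebra_def)

lemma curve_class_mult: "curve_class f (r * s) = curve_class f r \<otimes>\<^bsub>curve_ring f\<^esub> curve_class f s"
  using ring_hom_mult[OF curve_class_ring_hom, of r s f] by (simp add: ring_of_type_algebra_def)

lemma curve_class_one: "curve_class f 1 = \<one>\<^bsub>curve_ring f\<^esub>"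
  using ring_hom_one[OF curve_class_ring_hom, of f] by (simp add: ring_of_type_algebra_def)

lemma carrier_curve_ring: "carrier (curve_ring f) = range (curve_class f)"
  by (auto simp: curve_ring_def FactRing_def A_RCOSETS_defs curve_class_def a_r_coset_def
      ring_of_type_algebra_def)

lemma curve_class_closed [simp]: "curve_class f r \<in> carrier (curve_ring f)"
  by (simp add: carrier_curve_ring)

lemma cring_curve_ring: "cring (curve_ring f)"
  unfolding curve_ring_def
  by (rule ideal.quotient_is_cring[OF curve_ideal_ideal cring_from_type_algebra])

lemma curve_class_zero: "curve_class f 0 = \<zero>\<^bsub>curve_ring f\<^esub>"
proof -
  interpret A: cring "curve_ring f" by (rule cring_curve_ring)
  have "curve_class f 0 \<oplus>\<^bsub>curve_ring f\<^esub> curve_class f 0 = curve_class f 0"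
    using curve_class_add[of f 0 0] by simp
  then show ?thesis by (simp add: A.add.r_cancel_one)
qed

lemma curve_class_sum:
  "finite B \<Longrightarrow> curve_class f (sum g B) = (\<Oplus>\<^bsub>curve_ring f\<^esub>i\<in>B. curve_class f (g i))"
proof (induction B rule: finite_induct)
  case empty
  interpret A: cring "curve_ring f" by (rule cring_curve_ring)
  show ?case by (simp add: curve_class_zero)
next
  case (insert b B)
  interpret A: cring "curve_ring f" by (rule cring_curve_ring)
  show ?case using insert by (simp add: curve_class_add A.finsum_insert)
qed

lemma curve_class_power: "curve_class f (r ^ n) = curve_class f r [^]\<^bsub>curve_ring f\<^esub> (n::nat)"
proof -
  interpret A: cring "curve_ring f" by (rule cring_curve_ring)
  show ?thesis by (induction n) (simp_all add: curve_class_one curve_class_mult A.m_comm)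
qed

lemma curve_class_mult_cong:
  "curve_class f r = curve_class f r' \<Longrightarrow> curve_class f s = curve_class f s' \<Longrightarrow>
    curve_class f (r * s) = curve_class f (r' * s')"
  by (simp add: curve_class_mult)

lemma curve_class_yz: "curve_class f (y_var * z_var) = curve_class f 1"
  and curve_class_y2: "curve_class f (y_var ^ 2) = curve_class f (x_poly f)"
  by (simp_all add: curve_class_eq_iff curve_ideal_gens)

lemma curve_class_yz_power: "curve_class f (y_var ^ n * z_var ^ n) = curve_class f 1"
proof -
  have "curve_class f ((y_var * z_var) ^ n) = curve_class f (1 ^ n)"
    unfolding curve_class_power curve_class_yz ..
  then show ?thesis by (simp add: power_mult_distrib)
qed

text \<open>
  The relations are tested in an algebraic closure of \<open>F(x)\<close>, where \<open>f\<close> has an invertible square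
  root.
\<close>

lemma curve_class_x_poly_inj:
  fixes f :: "'a::field poly"
  assumes "f \<noteq> 0" "curve_class f (x_poly p) = curve_class f (x_poly q)"
  shows "p = q"
proof -
  define \<iota> :: "'a poly \<Rightarrow> 'a poly fract alg_closure" where "\<iota> = (\<lambda>p. to_ac (to_fract p))"
  have \<iota>: "type_ring_hom \<iota>" by unfold_locales (simp_all add: \<iota>_def)
  obtain w where w: "w ^ 2 = \<iota> f" using nth_root_exists[of 2 "\<iota> f"] by auto
  have "w \<noteq> 0" using w \<open>f \<noteq> 0\<close> by (auto simp: \<iota>_def)
  define \<psi> where "\<psi> = curve_eval \<iota> w (inverse w)"
  interpret \<psi>: type_ring_hom \<psi> unfolding \<psi>_def by (rule curve_eval_hom[OF \<iota>])
  note \<psi>_simps = curve_eval_simps[OF \<iota>, of w "inverse w", folded \<psi>_def]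
  have "ideal {0::'a poly fract alg_closure} ring_of_type_algebra" by (simp add: ideal_type_algebra_iff)
  \<comment> \<open>\<open>w^2\<close> is the image of \<open>f\<close> and \<open>w\<close> is
    invertible, so both generators go to 0. Hence \<open>\<psi>\<close> is constant on cosets, while
    on \<open>F[x]\<close> it is the injective map \<open>\<iota>\<close>.\<close>
  then have "curve_ideal f \<subseteq> \<psi> -` {0}"
    using \<open>w \<noteq> 0\<close> w
    by (intro curve_ideal_minimal ideal_vimage_type_algebra \<psi>.type_ring_hom_axioms)
      (simp_all add: \<psi>.hom_diff \<psi>.hom_mult \<psi>.hom_power \<psi>.hom_one \<psi>_simps)
  moreover have "x_poly p - x_poly q \<in> curve_ideal f" using assms(2) by (simp add: curve_class_eq_iff)
  ultimately have "\<psi> (x_poly p - x_poly q) = 0" by blast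
  then show ?thesis by (simp add: \<psi>.hom_diff \<psi>_simps \<iota>_def flip: to_ac_diff to_fract_diff)
qed

section \<open>The Taylor homomorphism\<close>

definition x_series :: "'a::field poly \<Rightarrow> 'a poly poly poly fps" where
  "x_series p = Abs_fps (\<lambda>k. x_poly (hasse_poly k p))"

lemma x_series_nth [simp]: "x_series p $ k = x_poly (hasse_poly k p)"
  by (simp add: x_series_def)

lemma x_series_hom: "type_ring_hom (x_series :: 'a::field poly \<Rightarrow> _)"
proof
  fix p q :: "'a poly"
  show "x_series (p + q) = x_series p + x_series q"
    by (rule fps_ext) (simp add: hasse_poly_add x_poly.hom_add)
  have "hasse_poly n (p * q) = (\<Sum>i=0..n. hasse_poly i p * hasse_poly (n - i) q)" for n
    using arg_cong[OF hasse_series_mult[of p q], of "\<lambda>A. A $ n"] by (simp add: fps_mult_nth)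
  then show "x_series (p * q) = x_series p * x_series q"
    by (intro fps_ext) (simp add: fps_mult_nth x_poly.hom_sum x_poly.hom_mult)
  have "hasse_poly n 1 = (if n = 0 then 1 else 0 :: 'a poly)" for n
    using arg_cong[OF hasse_series_1, of "\<lambda>A. A $ n"] by simp
  then show "x_series 1 = (1 :: 'a poly poly poly fps)"
    by (intro fps_ext) (simp add: x_poly.hom_one x_poly.hom_zero)
qed

text \<open>As \<open>z\<close> stands for \<open>1/y\<close> and \<open>y^2 = f\<close>, the factor
  \<open>z^(2k)\<close> is \<open>f^(-k)\<close>, and the series is \<open>S(t / f)\<close>.\<close>

definition sqrt_series :: "'a::field poly \<Rightarrow> 'a poly poly poly fps" where
  "sqrt_series f = Abs_fps (\<lambda>k. z_var ^ (2 * k) * x_poly (inflection_poly (1/2) f k))"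

lemma sqrt_series_0: "sqrt_series f $ 0 = 1"
  by (simp add: sqrt_series_def inflection_poly_def x_poly.hom_one)

lemma sqrt_series_square:
  assumes "(2 :: 'a::field) \<noteq> 0"
  shows "(sqrt_series f * sqrt_series f) $ n = z_var ^ (2 * n) * x_poly (taylor_quotient (f :: 'a poly) n)"
proof -
  have "2 * (1/2 :: 'a) = 1" using assms by simp
  from arg_cong[OF inflection_poly_square[OF this, of f], of "\<lambda>A. A $ n"]
  have "taylor_quotient f n = (\<Sum>i=0..n. inflection_poly (1/2) f i * inflection_poly (1/2) f (n - i))"
    by (simp add: fps_mult_nth)
  then have P: "x_poly (taylor_quotient f n) =
      (\<Sum>i=0..n. x_poly (inflection_poly (1/2) f i) * x_poly (inflection_poly (1/2) f (n - i)))"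
    by (simp only: x_poly.hom_mult x_poly.hom_sum)
  \<comment> \<open>The exponents of \<open>z\<close> add up to \<open>2 * n\<close> in every
    summand, so this power factors out of the convolution.\<close>
  have z: "z_var ^ (2 * n) = z_var ^ (2 * i) * (z_var ^ (2 * (n - i)) :: 'a poly poly poly)"
    if "i \<le> n" for i
  proof -
    have "2 * n = 2 * i + 2 * (n - i)" using that by simp
    then show ?thesis by (metis power_add)
  qed
  have "(sqrt_series f * sqrt_series f) $ n = (\<Sum>i=0..n. z_var ^ (2 * n) *
      (x_poly (inflection_poly (1/2) f i) * x_poly (inflection_poly (1/2) f (n - i))))"
    unfolding fps_mult_nth
  proof (rule sum.cong[OF refl])
    fix i assume "i \<in> {0..n}"
    then show "sqrt_series f $ i * sqrt_series f $ (n - i) = z_var ^ (2 * n) *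
        (x_poly (inflection_poly (1/2) f i) * x_poly (inflection_poly (1/2) f (n - i)))"
      by (subst z[of i]) (simp_all add: sqrt_series_def mult_ac)
  qed
  then show ?thesis by (simp only: P sum_distrib_left)
qed

text \<open>
  The substitution \<open>x \<mapsto> x + t\<close> on the free ring \<open>F[x, y, z]\<close>, with \<open>y \<mapsto> y S(z\<^sup>2 t)\<close> where
  \<open>S(s)\<^sup>2 = f(x + f s) / f(x)\<close>.
\<close>

definition curve_taylor :: "'a::field poly \<Rightarrow> 'a poly poly poly \<Rightarrow> 'a poly poly poly fps" where
  "curve_taylor f = curve_eval x_series (fps_const y_var * sqrt_series f)
     (fps_const z_var * fps_left_inverse (sqrt_series f) 1)"

lemma curve_taylor_hom: "type_ring_hom (curve_taylor f)"
  unfolding curve_taylor_def by (rule curve_eval_hom[OF x_series_hom])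

interpretation curve_taylor: type_ring_hom "curve_taylor f"
  by (rule curve_taylor_hom)

lemma curve_taylor_x_poly: "curve_taylor f (x_poly p) = x_series p"
  and curve_taylor_y: "curve_taylor f y_var = fps_const y_var * sqrt_series f"
  and curve_taylor_z: "curve_taylor f z_var = fps_const z_var * fps_left_inverse (sqrt_series f) 1"
  by (simp_all add: curve_taylor_def curve_eval_simps[OF x_series_hom])

lemma curve_taylor_nth_0: "curve_taylor f r $ 0 = r"
proof (induction r rule: poly3_induct)
  case z
  show ?case by (simp add: curve_taylor_z)
qed (simp_all add: curve_taylor_x_poly curve_taylor_y sqrt_series_0 curve_taylor.hom_add curve_taylor.hom_mult)

text \<open>The factors \<open>S\<close> and \<open>1/S\<close> cancel in the free ring, before any
  relation is imposed.\<close>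

lemma curve_taylor_yz: "curve_taylor f y_var * curve_taylor f z_var = fps_const (y_var * z_var)"
proof -
  have "fps_left_inverse (sqrt_series f) 1 * sqrt_series f = 1"
    by (rule fps_left_inverse) (simp add: sqrt_series_0)
  moreover have "curve_taylor f y_var * curve_taylor f z_var
      = fps_const y_var * fps_const z_var * (fps_left_inverse (sqrt_series f) 1 * sqrt_series f)"
    unfolding curve_taylor_y curve_taylor_z by (simp only: mult_ac)
  ultimately show ?thesis by simp
qed

text \<open>Preimages of ideals are ideals, so the two generators suffice. This makes the
  substitution descend to the curve ring.\<close>

lemma curve_taylor_ideal:
  assumes two: "(2 :: 'a::field) \<noteq> 0" and r: "r \<in> curve_ideal (f :: 'a poly)"
  shows "curve_taylor f r \<in> fps_ideal (curve_ideal f)"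
proof -
  let ?J = "curve_taylor f -` fps_ideal (curve_ideal f)"
  have J: "ideal ?J ring_of_type_algebra"
    by (intro ideal_vimage_type_algebra curve_taylor_hom fps_ideal_ideal curve_ideal_ideal)
  have zero: "0 \<in> curve_ideal f"
    using curve_ideal_ideal[of f] by (simp add: ideal_type_algebra_iff)
  have "curve_taylor f (y_var * z_var - 1) = fps_const (y_var * z_var - 1)"
    by (simp add: curve_taylor.hom_diff curve_taylor.hom_mult curve_taylor.hom_one curve_taylor_yz
        flip: fps_const_sub)
  then have yz: "y_var * z_var - 1 \<in> ?J"
    using curve_ideal_gens(1)[of f] zero by (simp add: fps_ideal_def)
  \<comment> \<open>For \<open>k > 0\<close>, \<open>f^(k-1)\<close> becomes
    \<open>y^(2k-2)\<close>, and \<open>y^(2k) z^(2k)\<close> is 1. At \<open>k = 0\<close> the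
    claim is the relation \<open>y^2 = f\<close>.\<close>
  have "curve_class f (y_var ^ 2 * (z_var ^ (2 * k) * x_poly (taylor_quotient f k)))
      = curve_class f (x_poly (hasse_poly k f))" for k
  proof (cases k)
    case 0
    then show ?thesis by (simp add: taylor_quotient_def x_poly.hom_one curve_class_y2)
  next
    case (Suc m)
    have y: "y_var ^ (2 * k) = (y_var :: 'a poly poly poly) ^ 2 * (y_var ^ 2) ^ m"
      by (simp only: Suc power_mult power_Suc)
    have "curve_class f (x_poly f ^ m) = curve_class f ((y_var ^ 2) ^ m)"
      unfolding curve_class_power[of f "x_poly f" m] curve_class_power[of f "y_var ^ 2" m] curve_class_y2 ..
    then have "curve_class f ((y_var ^ 2 * z_var ^ (2 * k)) * (x_poly f ^ m * x_poly (hasse_poly k f)))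
      = curve_class f ((y_var ^ 2 * z_var ^ (2 * k)) * ((y_var ^ 2) ^ m * x_poly (hasse_poly k f)))"
      by (intro curve_class_mult_cong refl)
    also have "(y_var ^ 2 * z_var ^ (2 * k)) * ((y_var ^ 2) ^ m * x_poly (hasse_poly k f))
      = (y_var ^ (2 * k) * z_var ^ (2 * k)) * x_poly (hasse_poly k f)"
      unfolding y by (simp only: mult_ac)
    also have "curve_class f \<dots> = curve_class f (1 * x_poly (hasse_poly k f))"
      by (intro curve_class_mult_cong curve_class_yz_power refl)
    finally show ?thesis
      by (simp add: Suc taylor_quotient_def x_poly.hom_mult x_poly.hom_power mult.assoc)
  qed
  then have "y_var ^ 2 * (z_var ^ (2 * k) * x_poly (taylor_quotient f k)) - x_poly (hasse_poly k f)
      \<in> curve_ideal f" for k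
    by (simp add: curve_class_eq_iff)
  moreover have "curve_taylor f (y_var ^ 2 - x_poly f) $ k
      = y_var ^ 2 * (z_var ^ (2 * k) * x_poly (taylor_quotient f k)) - x_poly (hasse_poly k f)" for k
  proof -
    have "curve_taylor f (y_var ^ 2 - x_poly f)
        = fps_const (y_var ^ 2) * (sqrt_series f * sqrt_series f) - x_series f"
      by (simp add: curve_taylor.hom_diff curve_taylor.hom_power curve_taylor_y curve_taylor_x_poly
          power_mult_distrib fps_const_power power2_eq_square[of "sqrt_series f"])
    then show ?thesis by (simp add: sqrt_series_square[OF two])
  qed
  ultimately have "y_var ^ 2 - x_poly f \<in> ?J"
    by (simp add: fps_ideal_def)
  with curve_ideal_minimal[OF J yz] r show ?thesis by blast
qed

section \<open>Uniqueness and existence of the Hasse derivatives on the curve ring\<close>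

text \<open>
  An extension sends \<open>y\<close> to a square root of \<open>f(x + t)\<close> with constant term \<open>y\<close>, and there is only
  one, because \<open>2 y\<close> is a unit. Classes are replaced by representatives, so that power series
  over \<open>F[x, y, z]\<close> modulo the ideal can be used.
\<close>

lemma is_hasse_extension_unique:
  fixes f :: "'a::field poly"
  assumes two: "(2 :: 'a) \<noteq> 0" and D: "is_hasse_extension f D"
  shows "D k (curve_class f r) = curve_class f (curve_taylor f r $ k)"
proof -
  note D' = D[unfolded is_hasse_extension_def Let_def]
  note D_x = D'[THEN conjunct2, THEN conjunct1, rule_format]
  note D_add = D'[THEN conjunct2, THEN conjunct2, THEN conjunct1, rule_format]
  note D_0 = D'[THEN conjunct2, THEN conjunct2, THEN conjunct2, THEN conjunct2, THEN conjunct1, rule_format]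
  note D_mult = D'[THEN conjunct2, THEN conjunct2, THEN conjunct2, THEN conjunct2, THEN conjunct2, rule_format]
  have closed: "D k (curve_class f r) \<in> carrier (curve_ring f)" for k r
    using D'[THEN conjunct1, rule_format, of k] curve_class_closed[of f r] by (rule PiE_mem)
  \<comment> \<open>Representatives of the classes \<open>D k\<close> form a power series
    \<open>e r\<close> over the free ring; \<open>e\<close> respects the ring operations only modulo
    \<open>J\<close>.\<close>
  define rep where "rep = (\<lambda>c. SOME s. curve_class f s = c)"
  have rep: "curve_class f (rep c) = c" if "c \<in> carrier (curve_ring f)" for c
    unfolding rep_def by (rule someI_ex) (use that in \<open>auto simp: carrier_curve_ring\<close>)
  define e where "e = (\<lambda>r. Abs_fps (\<lambda>k. rep (D k (curve_class f r))))"
  have e: "curve_class f (e r $ k) = D k (curve_class f r)" for r k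
    by (simp add: e_def rep closed)
  define J where "J = fps_ideal (curve_ideal f)"
  have J: "ideal J ring_of_type_algebra"
    unfolding J_def by (intro fps_ideal_ideal curve_ideal_ideal)
  note J_diff = ideal_type_algebra_diff[OF J]
  have J_add: "a + b \<in> J" if "a \<in> J" "b \<in> J" for a b
    using J that by (simp add: ideal_type_algebra_iff)
  have J_mult: "a * b \<in> J" if "b \<in> J" for a b
    using J that by (simp add: ideal_type_algebra_iff)
  have J_iff: "a - b \<in> J \<longleftrightarrow> (\<forall>k. curve_class f (a $ k) = curve_class f (b $ k))" for a b
    by (simp add: J_def fps_ideal_def curve_class_eq_iff)
  have e_cong: "e r = e s" if "curve_class f r = curve_class f s" for r s
    by (simp add: e_def that)
  have e_x: "e (x_poly p) - x_series p \<in> J" for p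
    by (simp add: J_iff e D_x)
  have e_add: "e (r + s) - (e r + e s) \<in> J" for r s
    by (simp add: J_iff e curve_class_add D_add)
  have e_mult: "e (r * s) - e r * e s \<in> J" for r s
    by (simp add: J_iff e fps_mult_nth curve_class_sum curve_class_mult D_mult)
  have e_0: "e r $ 0 - r \<in> curve_ideal f" for r
    by (simp add: e D_0 flip: curve_class_eq_iff)
  define T where "T = curve_taylor f"
  have "e y_var - T y_var \<in> J"
    unfolding J_def
  proof (rule fps_ideal_cancel[OF curve_ideal_ideal])
    have "T y_var * T y_var - x_series f = T (y_var ^ 2 - x_poly f)"
      by (simp add: T_def curve_taylor.hom_diff curve_taylor.hom_mult curve_taylor_x_poly power2_eq_square)
    then have T: "T y_var * T y_var - x_series f \<in> J"
      using curve_taylor_ideal[OF two curve_ideal_gens(2)] by (simp add: T_def J_def)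
    have "e (y_var * y_var) = e (x_poly f)"
      by (rule e_cong) (simp add: curve_class_y2 flip: power2_eq_square)
    \<comment> \<open>Both \<open>e y_var\<close> and \<open>T y_var\<close> square to
      \<open>f(x + t)\<close> modulo \<open>J\<close>; the difference of the squares
      factors.\<close>
    then have "(e (x_poly f) - x_series f) - (e (y_var * y_var) - e y_var * e y_var)
        - (T y_var * T y_var - x_series f) \<in> J"
      by (intro J_diff e_x e_mult T)
    then have "(e y_var - T y_var) * (e y_var + T y_var) \<in> J"
      using \<open>e (y_var * y_var) = e (x_poly f)\<close> by (simp add: algebra_simps)
    then show "(e y_var - T y_var) * (e y_var + T y_var) \<in> fps_ideal (curve_ideal f)"
      by (simp add: J_def)
    \<comment> \<open>Modulo the ideal, \<open>e y_var + T y_var\<close> has constant term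
      \<open>2 y\<close>, with inverse \<open>z / 2\<close>.\<close>
    define c where "c = x_poly [:1/2 :: 'a:]"
    have c: "c * 2 = 1"
    proof -
      have "c * 2 = x_poly ([:1/2:] * 2)"
        by (simp add: c_def x_poly_def numeral_poly)
      also have "[:1/2 :: 'a:] * 2 = 1" using two by (simp add: numeral_poly one_pCons)
      finally show ?thesis by (simp add: x_poly.hom_one)
    qed
    have "T y_var $ 0 = y_var" by (simp add: T_def curve_taylor_nth_0)
    moreover have "c * z_var * (e y_var $ 0 - y_var) + (y_var * z_var - 1) \<in> curve_ideal f"
      using e_0[of y_var] curve_ideal_gens(1)[of f] curve_ideal_ideal[of f]
      by (simp add: ideal_type_algebra_iff)
    moreover have "c * z_var * (e y_var $ 0 - y_var) + (y_var * z_var - 1)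
        = c * z_var * (e y_var $ 0 + y_var) - 1 + (y_var * z_var - (c * 2) * (y_var * z_var))"
      by (simp add: algebra_simps)
    ultimately show "(c * z_var) * (e y_var + T y_var) $ 0 - 1 \<in> curve_ideal f"
      by (simp add: c)
  qed
  note e_y = this
  have "e z_var - T z_var \<in> J"
    unfolding J_def
  proof (rule fps_ideal_cancel[OF curve_ideal_ideal])
    have "T y_var * T z_var - 1 = T (y_var * z_var - 1)"
      by (simp add: T_def curve_taylor.hom_diff curve_taylor.hom_mult curve_taylor.hom_one)
    then have T: "T y_var * T z_var - 1 \<in> J"
      using curve_taylor_ideal[OF two curve_ideal_gens(1)] by (simp add: T_def J_def)
    have eq: "e (y_var * z_var) = e (x_poly 1)"
      by (rule e_cong) (simp add: curve_class_yz x_poly.hom_one)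
    \<comment> \<open>Both \<open>e y_var * e z_var\<close> and \<open>T y_var * T z_var\<close> are
      1 modulo \<open>J\<close>; the last summand exchanges \<open>T y_var\<close> for
      \<open>e y_var\<close>.\<close>
    have "(e (x_poly 1) - x_series 1) - (e (y_var * z_var) - e y_var * e z_var)
        - (T y_var * T z_var - 1) - T z_var * (e y_var - T y_var) \<in> J"
      by (intro J_diff e_x e_mult T J_mult e_y)
    moreover have "(e (x_poly 1) - x_series 1) - (e (y_var * z_var) - e y_var * e z_var)
        - (T y_var * T z_var - 1) - T z_var * (e y_var - T y_var) = (e z_var - T z_var) * e y_var"
      unfolding eq type_ring_hom.hom_one[OF x_series_hom] by (simp add: algebra_simps)
    ultimately show "(e z_var - T z_var) * e y_var \<in> fps_ideal (curve_ideal f)"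
      by (simp add: J_def)
    have "z_var * (e y_var $ 0 - y_var) + (y_var * z_var - 1) \<in> curve_ideal f"
      using e_0[of y_var] curve_ideal_gens(1)[of f] curve_ideal_ideal[of f]
      by (simp add: ideal_type_algebra_iff)
    then show "z_var * e y_var $ 0 - 1 \<in> curve_ideal f"
      by (simp add: algebra_simps)
  qed
  note e_z = this
  \<comment> \<open>\<open>e\<close> and \<open>T\<close> agree on generators modulo
    \<open>J\<close> and respect sums and products there.\<close>
  have "e r - T r \<in> J"
  proof (induction r rule: poly3_induct)
    case (x_poly p)
    then show ?case using e_x by (simp add: T_def curve_taylor_x_poly)
  next
    case (add r s)
    have "(e (r + s) - (e r + e s)) + ((e r - T r) + (e s - T s)) \<in> J"
      by (intro J_add e_add add)
    then show ?case by (simp add: T_def curve_taylor.hom_add algebra_simps)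
  next
    case (mult r s)
    have "(e (r * s) - e r * e s) + (e s * (e r - T r) + T r * (e s - T s)) \<in> J"
      by (intro J_add e_mult J_mult mult)
    then show ?case by (simp add: T_def curve_taylor.hom_mult algebra_simps)
  qed (fact e_y e_z)+
  then show ?thesis by (simp add: J_iff e T_def)
qed

text \<open>Take coefficients of \<open>curve_taylor\<close>; by \<open>curve_taylor_ideal\<close>
  their classes do not depend on the representative. Multiplicativity becomes the Leibniz rule, and
  \<open>F\<close>-linearity holds because the expansion of a constant is constant.\<close>

lemma is_hasse_extension_exists:
  fixes f :: "'a::field poly"
  assumes two: "(2 :: 'a) \<noteq> 0"
  shows "\<exists>D. is_hasse_extension f D"
proof
  define rep where "rep = (\<lambda>c. SOME s. curve_class f s = c)"
  define D where "D = (\<lambda>k. restrict (\<lambda>c. curve_class f (curve_taylor f (rep c) $ k)) (carrier (curve_ring f)))"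
  have D: "D k (curve_class f r) = curve_class f (curve_taylor f r $ k)" for k r
  proof -
    have "curve_class f (rep (curve_class f r)) = curve_class f r"
      unfolding rep_def by (rule someI) (rule refl)
    then have "rep (curve_class f r) - r \<in> curve_ideal f" by (simp add: curve_class_eq_iff)
    from curve_taylor_ideal[OF two this]
    show ?thesis
      by (simp add: D_def curve_taylor.hom_diff fps_ideal_def curve_class_eq_iff)
  qed
  have "D k \<in> carrier (curve_ring f) \<rightarrow>\<^sub>E carrier (curve_ring f)" for k
    by (auto simp: D_def)
  moreover have "D k (curve_class f r \<oplus>\<^bsub>curve_ring f\<^esub> curve_class f s)
      = D k (curve_class f r) \<oplus>\<^bsub>curve_ring f\<^esub> D k (curve_class f s)" for k r s
    by (simp add: D curve_taylor.hom_add flip: curve_class_add)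
  moreover have "D k (curve_class f (x_poly [:c:]) \<otimes>\<^bsub>curve_ring f\<^esub> curve_class f r)
      = curve_class f (x_poly [:c:]) \<otimes>\<^bsub>curve_ring f\<^esub> D k (curve_class f r)" for k c r
  proof -
    have "curve_taylor f (x_poly [:c:]) = fps_const (x_poly [:c:])"
    proof (rule fps_ext)
      fix n
      have "hasse_poly n [:c:] = (if n = 0 then [:c:] else 0)"
        using hasse_poly_Suc_pCons[of _ c 0] by (cases n) simp_all
      then show "curve_taylor f (x_poly [:c:]) $ n = fps_const (x_poly [:c:]) $ n"
        by (simp add: curve_taylor_x_poly x_poly.hom_zero)
    qed
    then show ?thesis by (simp add: D curve_taylor.hom_mult flip: curve_class_mult)
  qed
  moreover have "D k (curve_class f r \<otimes>\<^bsub>curve_ring f\<^esub> curve_class f s)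
      = (\<Oplus>\<^bsub>curve_ring f\<^esub>i\<in>{0..k}. D i (curve_class f r) \<otimes>\<^bsub>curve_ring f\<^esub> D (k - i) (curve_class f s))" for k r s
    by (simp add: D curve_taylor.hom_mult fps_mult_nth curve_class_sum flip: curve_class_mult)
  ultimately show "is_hasse_extension f D"
    unfolding is_hasse_extension_def Let_def carrier_curve_ring
    by (simp add: D curve_taylor_x_poly curve_taylor_nth_0)
qed

text \<open>Uniqueness on cosets, with extensionality outside the carrier, justifies the definite
  description.\<close>

lemma hasse_curve_class:
  fixes f :: "'a::field poly"
  assumes two: "(2 :: 'a) \<noteq> 0"
  shows "hasse_curve f k (curve_class f r) = curve_class f (curve_taylor f r $ k)"
proof -
  obtain D where D: "is_hasse_extension f D"
    using is_hasse_extension_exists[OF two] by blast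
  have "E = D" if E: "is_hasse_extension f E" for E
  proof (intro ext)
    fix k c
    show "E k c = D k c"
    proof (cases "c \<in> carrier (curve_ring f)")
      case True
      then obtain r where "c = curve_class f r" by (auto simp: carrier_curve_ring)
      then show ?thesis
        using is_hasse_extension_unique[OF two D] is_hasse_extension_unique[OF two E] by simp
    next
      case False
      then show ?thesis
        using PiE_arb[OF D[unfolded is_hasse_extension_def Let_def, THEN conjunct1, rule_format]]
          PiE_arb[OF E[unfolded is_hasse_extension_def Let_def, THEN conjunct1, rule_format]]
        by simp
    qed
  qed
  with D have "is_hasse_extension f (hasse_curve f)"
    unfolding hasse_curve_def by (rule theI)
  then show ?thesis by (rule is_hasse_extension_unique[OF two])
qed

section \<open>Atomic inflection polynomials as coefficients of the square root\<close>

lemma atomic_inflection_eq: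
  fixes f :: "'a::field poly"
  assumes two: "(2 :: 'a) \<noteq> 0" and "f \<noteq> 0"
  shows "atomic_inflection f n = inflection_poly (1/2) f n"
proof -
  interpret A: cring "curve_ring f" by (rule cring_curve_ring)
  \<comment> \<open>\<open>z^2\<close> represents \<open>1/f\<close>, so the factor
    \<open>f^(-n) y\<close> in the definition becomes \<open>z^(2n) y\<close>.\<close>
  have "curve_class f (x_poly f * z_var ^ 2) = curve_class f (y_var ^ 2 * z_var ^ 2)"
    by (intro curve_class_mult_cong curve_class_y2[symmetric] refl)
  also have "\<dots> = curve_class f 1" by (rule curve_class_yz_power)
  finally have "inv\<^bsub>curve_ring f\<^esub> (curve_class f (x_poly f)) = curve_class f (z_var ^ 2)"
    by (intro A.comm_inv_char) (simp_all add: curve_class_mult curve_class_one)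
  then have rhs: "(inv\<^bsub>curve_ring f\<^esub> (curve_class f (x_poly f))) [^]\<^bsub>curve_ring f\<^esub> n
      \<otimes>\<^bsub>curve_ring f\<^esub> curve_class f y_var \<otimes>\<^bsub>curve_ring f\<^esub> curve_class f (x_poly P)
      = curve_class f (z_var ^ (2 * n) * y_var * x_poly P)" for P
    by (simp add: curve_class_mult power_mult flip: curve_class_power)
  have lhs: "hasse_curve f n (curve_class f y_var)
      = curve_class f (z_var ^ (2 * n) * y_var * x_poly (inflection_poly (1/2) f n))"
    by (simp add: hasse_curve_class[OF two] curve_taylor_y sqrt_series_def mult_ac)
  have uniq: "P = Q" if eq: "curve_class f (z_var ^ (2 * n) * y_var * x_poly P)
      = curve_class f (z_var ^ (2 * n) * y_var * x_poly Q)" for P Q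
  proof -
    \<comment> \<open>\<open>y^(2n) z\<close> inverts \<open>z^(2n) y\<close> modulo the
      ideal.\<close>
    have cancel: "curve_class f ((y_var ^ (2 * n) * z_var) * (z_var ^ (2 * n) * y_var * x_poly R))
        = curve_class f (x_poly R)" for R
    proof -
      have "(y_var ^ (2 * n) * z_var) * (z_var ^ (2 * n) * y_var * x_poly R)
          = (y_var ^ Suc (2 * n) * z_var ^ Suc (2 * n)) * x_poly R"
        by (simp add: mult_ac)
      also have "curve_class f \<dots> = curve_class f (1 * x_poly R)"
        by (intro curve_class_mult_cong curve_class_yz_power refl)
      finally show ?thesis by simp
    qed
    have "curve_class f (x_poly P) = curve_class f (x_poly Q)"
      using curve_class_mult_cong[OF refl eq, of "y_var ^ (2 * n) * z_var"] by (simp only: cancel)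
    then show ?thesis by (rule curve_class_x_poly_inj[OF \<open>f \<noteq> 0\<close>])
  qed
  show ?thesis
    unfolding atomic_inflection_def rhs lhs
    by (rule the_equality) (rule refl, rule uniq, erule sym)
qed

section \<open>The recursion over the field and over its lifts\<close>

theorem proposition3p13:
  fixes f :: "'a::field poly" and g :: nat
  assumes "CHAR('a) \<noteq> 2"
    and "Polynomial.degree f = 2 * g + 1"
    and "rsquarefree (map_poly to_ac f)"
  shows
    "atomic_inflection f 1 = smult (1/2) (hasse_poly 1 f) \<and>
     (\<forall>n\<ge>1. of_nat (n + 1) \<noteq> (0::'a) \<longrightarrow>
        atomic_inflection f (n + 1) =
          smult (1 / of_nat (n + 1))
            (hasse_poly 1 (atomic_inflection f n) * f
              + smult (- of_nat n + 1/2) (atomic_inflection f n) * hasse_poly 1 f)) \<and>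
     inflection_recursion (1/2) f (atomic_inflection f) \<and>
     (\<forall>(h::'r::{idom,ring_char_0}) \<phi> F.
        2 * h = 1 \<and> \<phi> \<in> ring_hom ring_of_type_algebra ring_of_type_algebra \<and> map_poly \<phi> F = f \<longrightarrow>
          (\<exists>Q. inflection_recursion h F Q) \<and>
          (\<forall>Q. inflection_recursion h F Q \<longrightarrow>
             (\<forall>n\<ge>1. atomic_inflection f n = map_poly \<phi> (Q n))))"
proof -
  have "\<not> CHAR('a) dvd 2"
  proof
    assume dvd: "CHAR('a) dvd 2"
    then have "CHAR('a) \<le> 2" by (rule dvd_imp_le) simp
    moreover have "CHAR('a) \<noteq> 0" using dvd by (metis dvd_0_left_iff zero_neq_numeral)
    moreover have "CHAR('a) \<noteq> 1" by simp
    ultimately show False using assms(1) by linarith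
  qed
  then have two: "(2 :: 'a) \<noteq> 0"
    using of_nat_eq_0_iff_char_dvd[where 'a = 'a, of 2] by simp
  have "f \<noteq> 0" using assms(2) by auto
  have atomic: "atomic_inflection f = inflection_poly (1/2) f"
    using atomic_inflection_eq[OF two \<open>f \<noteq> 0\<close>] by blast
  have rec: "inflection_recursion (1/2) f (atomic_inflection f)"
    unfolding atomic by (rule inflection_poly_recursion) (use two in simp)
  have step: "atomic_inflection f (n + 1) =
          smult (1 / of_nat (n + 1))
            (hasse_poly 1 (atomic_inflection f n) * f
              + smult (- of_nat n + 1/2) (atomic_inflection f n) * hasse_poly 1 f)"
    if "n \<ge> 1" "of_nat (n + 1) \<noteq> (0::'a)" for n
  proof -
    have "atomic_inflection f (n + 1)
        = smult (1 / of_nat (n + 1)) (smult (of_nat (n + 1)) (atomic_inflection f (n + 1)))"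
      using that(2) by (simp del: of_nat_add)
    also have "smult (of_nat (n + 1)) (atomic_inflection f (n + 1)) =
        hasse_poly 1 (atomic_inflection f n) * f
          + smult (- of_nat n + 1/2) (atomic_inflection f n) * hasse_poly 1 f"
      using rec that(1) unfolding inflection_recursion_def by blast
    finally show ?thesis .
  qed
  \<comment> \<open>\<open>inflection_poly h F\<close> is one solution, and \<open>\<phi>\<close>
    carries it to that of \<open>f\<close> because \<open>\<phi> h\<close> must be
    \<open>1/2\<close>. Uniqueness in characteristic 0 extends this to every solution from index 1
    on.\<close>
  have lift: "(\<exists>Q. inflection_recursion h F Q) \<and>
      (\<forall>Q. inflection_recursion h F Q \<longrightarrow> (\<forall>n\<ge>1. atomic_inflection f n = map_poly \<phi> (Q n)))"
    if h: "2 * h = 1" and \<phi>: "\<phi> \<in> ring_hom ring_of_type_algebra ring_of_type_algebra"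
      and F: "map_poly \<phi> F = f" for h :: 'r and \<phi> F
  proof -
    interpret \<phi>: type_ring_hom \<phi>
      by unfold_locales
        (use ring_hom_add[OF \<phi>] ring_hom_mult[OF \<phi>] ring_hom_one[OF \<phi>] in
          \<open>simp_all add: ring_of_type_algebra_def\<close>)
    have \<phi>_h: "\<phi> h = 1/2"
    proof -
      have "2 * \<phi> h = 1"
        using \<phi>.hom_mult[of 2 h] \<phi>.hom_of_nat[of 2] h \<phi>.hom_one by simp
      then show ?thesis using two by (simp add: field_simps)
    qed
    have "map_poly \<phi> (inflection_poly h F n) = atomic_inflection f n" for n
      unfolding \<phi>.map_poly_inflection_poly F \<phi>_h atomic ..
    then show ?thesis
      using inflection_poly_recursion[OF h, of F] inflection_recursion_unique[of h F] by metis
  qed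
  show ?thesis
    using rec step lift unfolding inflection_recursion_def[of "1/2"] by blast
qed

end
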